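(* Let $p,q$ be distinct propositional variables. The formula $p\rhd q$, which is left-modalized in $p$, has no fixed points in $\mathbf{CL}$. That is, for any formula $A$ which satisfies $v(A)\subseteq\{q\}$, $$\mathbf{CL} \nvdash A \leftrightarrow (A\rhd q).$$
   Context: Formulas are generated by $A ::= \bot \mid p \mid A \to A \mid \Box A \mid A \rhd A$, where $p$ ranges over a countably infinite set of propositional variables. The symbols $\neg,\land,\lor,\leftrightarrow,\top,\Diamond$ (with $\Diamond A := \neg\Box\neg A$) are the usual abbreviations. $\neg,\Box,\Diamond$ bind most strongly. $v(A)$ is the set of propositional variables contained in $A$. A formula $A$ is left-modalized in $p$ if every occurrence of $p$ in $A$ is in the scope of some $\Box$ or $\rhd$, and $p\notin v(C)$ for any subformula $B\rhd C$ of $A$. The conservativity logic $\mathbf{CL}$ has as axioms all instances of: $\mathbf{L1}$: all tautologies in this language; $\mathbf{L2}$: $\Box(A\to B)\to(\Box A\to\Box B)$; $\mathbf{L3}$: $\Box(\Box A\to A)\to\Box A$; $\mathbf{J1}$: $\Box(A\to B)\to(A\rhd B)$; $\mathbf{J2}$: $((A\rhd B)\land(B\rhd C))\to(A\rhd C)$; $\mathbf{J3}$: $((A\rhd C)\land(B\rhd C))\to((A\lor B)\rhd C)$; $\mathbf{J4}$: $(A\rhd B)\to(\Diamond A\to\Diamond B)$. Its inference rules are Modus Ponens and Necessitation (from $A$ infer $\Box A$). $L\nvdash A$ means that $A$ is not a theorem of $L$. *)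

theory Defs imports Main
begin

datatype fm =
    Bot ("\<^bold>\<bottom>")
  | Var nat
  | Imp fm fm (infixr "\<^bold>\<longrightarrow>" 25)
  | Box fm ("\<^bold>\<box>_" [80] 80)
  | Rhd fm fm (infix "\<rhd>" 55)

abbreviation Neg :: "fm \<Rightarrow> fm" ("\<^bold>\<not>_" [80] 80)
  where "\<^bold>\<not>A \<equiv> (A \<^bold>\<longrightarrow> \<^bold>\<bottom>)"

abbreviation Dis :: "fm \<Rightarrow> fm \<Rightarrow> fm" (infixr "\<^bold>\<or>" 30)
  where "A \<^bold>\<or> B \<equiv> (\<^bold>\<not>A \<^bold>\<longrightarrow> B)"

abbreviation Con :: "fm \<Rightarrow> fm \<Rightarrow> fm" (infixr "\<^bold>\<and>" 35)
  where "A \<^bold>\<and> B \<equiv> \<^bold>\<not>(A \<^bold>\<longrightarrow> \<^bold>\<not>B)"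

abbreviation Iff :: "fm \<Rightarrow> fm \<Rightarrow> fm" (infix "\<^bold>\<longleftrightarrow>" 25)
  where "A \<^bold>\<longleftrightarrow> B \<equiv> ((A \<^bold>\<longrightarrow> B) \<^bold>\<and> (B \<^bold>\<longrightarrow> A))"

abbreviation Dia :: "fm \<Rightarrow> fm" ("\<^bold>\<diamond>_" [80] 80)
  where "\<^bold>\<diamond>A \<equiv> \<^bold>\<not>\<^bold>\<box>\<^bold>\<not>A"

primrec vars :: "fm \<Rightarrow> nat set" where
  "vars \<^bold>\<bottom> = {}"
| "vars (Var p) = {p}"
| "vars (A \<^bold>\<longrightarrow> B) = vars A \<union> vars B"
| "vars (\<^bold>\<box>A) = vars A"
| "vars (A \<rhd> B) = vars A \<union> vars B"

primrec subfms :: "fm \<Rightarrow> fm set" where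
  "subfms \<^bold>\<bottom> = {\<^bold>\<bottom>}"
| "subfms (Var p) = {Var p}"
| "subfms (A \<^bold>\<longrightarrow> B) = {A \<^bold>\<longrightarrow> B} \<union> subfms A \<union> subfms B"
| "subfms (\<^bold>\<box>A) = {\<^bold>\<box>A} \<union> subfms A"
| "subfms (A \<rhd> B) = {A \<rhd> B} \<union> subfms A \<union> subfms B"

text \<open>The variables with at least one occurrence outside the scope of every modality.\<close>

primrec exposed_vars :: "fm \<Rightarrow> nat set" where
  "exposed_vars \<^bold>\<bottom> = {}"
| "exposed_vars (Var p) = {p}"
| "exposed_vars (A \<^bold>\<longrightarrow> B) = exposed_vars A \<union> exposed_vars B"
| "exposed_vars (\<^bold>\<box>A) = {}"
| "exposed_vars (A \<rhd> B) = {}"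

definition left_modalized :: "nat \<Rightarrow> fm \<Rightarrow> bool" where
  "left_modalized p A \<longleftrightarrow>
     p \<notin> exposed_vars A \<and> (\<forall>B C. B \<rhd> C \<in> subfms A \<longrightarrow> p \<notin> vars C)"

text \<open>
  Tautologies of the modal language are substitution instances of propositional tautologies,
  so variables and formulas with outermost \<open>\<box>\<close> or \<open>\<rhd>\<close> are all evaluated as atoms:
  the valuation assigns them arbitrary, mutually independent truth values.
\<close>

primrec eval_prop :: "(fm \<Rightarrow> bool) \<Rightarrow> fm \<Rightarrow> bool" where
  "eval_prop V \<^bold>\<bottom> \<longleftrightarrow> False"
| "eval_prop V (Var p) \<longleftrightarrow> V (Var p)"
| "eval_prop V (A \<^bold>\<longrightarrow> B) \<longleftrightarrow> (eval_prop V A \<longrightarrow> eval_prop V B)"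
| "eval_prop V (\<^bold>\<box>A) \<longleftrightarrow> V (\<^bold>\<box>A)"
| "eval_prop V (A \<rhd> B) \<longleftrightarrow> V (A \<rhd> B)"

definition tautology :: "fm \<Rightarrow> bool" where
  "tautology A \<longleftrightarrow> (\<forall>V. eval_prop V A)"

inductive CL :: "fm \<Rightarrow> bool" where
  L1: "tautology A \<Longrightarrow> CL A"
| L2: "CL (\<^bold>\<box>(A \<^bold>\<longrightarrow> B) \<^bold>\<longrightarrow> (\<^bold>\<box>A \<^bold>\<longrightarrow> \<^bold>\<box>B))"
| L3: "CL (\<^bold>\<box>(\<^bold>\<box>A \<^bold>\<longrightarrow> A) \<^bold>\<longrightarrow> \<^bold>\<box>A)"
| J1: "CL (\<^bold>\<box>(A \<^bold>\<longrightarrow> B) \<^bold>\<longrightarrow> (A \<rhd> B))"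
| J2: "CL (((A \<rhd> B) \<^bold>\<and> (B \<rhd> C)) \<^bold>\<longrightarrow> (A \<rhd> C))"
| J3: "CL (((A \<rhd> C) \<^bold>\<and> (B \<rhd> C)) \<^bold>\<longrightarrow> ((A \<^bold>\<or> B) \<rhd> C))"
| J4: "CL ((A \<rhd> B) \<^bold>\<longrightarrow> (\<^bold>\<diamond>A \<^bold>\<longrightarrow> \<^bold>\<diamond>B))"
| MP: "CL (A \<^bold>\<longrightarrow> B) \<Longrightarrow> CL A \<Longrightarrow> CL B"
| Nec: "CL A \<Longrightarrow> CL (\<^bold>\<box>A)"

end

theory Submission imports Defs
begin

text \<open>
  Take the Veltman model for \<open>CL\<close> on the natural numbers in which \<open>n\<close> sees exactly the \<open>m < n\<close>
  and \<open>y S\<^sub>n z\<close> holds iff \<open>y = z\<close>, or \<open>z = 0\<close> and \<open>y + 1 < n\<close>; every variable is true only at \<open>0\<close>.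
  The predecessor of \<open>n\<close> is thus the only world below \<open>n\<close> that cannot reach \<open>0\<close>, so for \<open>n \<ge> 2\<close>
  the formula \<open>A \<rhd> q\<close> holds at \<open>n\<close> iff \<open>A\<close> fails at \<open>n - 1\<close>. A fixed point would therefore
  alternate in truth value along the model, whereas the truth value of every formula is
  eventually constant.
\<close>

primrec forces :: "nat \<Rightarrow> fm \<Rightarrow> bool" where
  "forces n \<^bold>\<bottom> \<longleftrightarrow> False"
| "forces n (Var p) \<longleftrightarrow> n = 0"
| "forces n (A \<^bold>\<longrightarrow> B) \<longleftrightarrow> (forces n A \<longrightarrow> forces n B)"
| "forces n (\<^bold>\<box>A) \<longleftrightarrow> (\<forall>m<n. forces m A)"
| "forces n (A \<rhd> B) \<longleftrightarrow> (\<forall>y<n. forces y A \<longrightarrow> forces y B \<or> Suc y < n \<and> forces 0 B)"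

text \<open>\<open>forces n\<close> is itself one of the valuations that \<open>tautology\<close>
  quantifies over.\<close>

lemma eval_prop_forces: "eval_prop (forces n) A \<longleftrightarrow> forces n A"
  by (induction A) auto

lemma forces_Loeb: "forces n (\<^bold>\<box>(\<^bold>\<box>A \<^bold>\<longrightarrow> A) \<^bold>\<longrightarrow> \<^bold>\<box>A)"
proof -
  have "forces m A" if "\<forall>k<n. (\<forall>j<k. forces j A) \<longrightarrow> forces k A" "m < n" for m
    using \<open>m < n\<close>
  proof (induction m rule: less_induct)
    case (less m)
    then have "\<forall>j<m. forces j A" by simp
    then show ?case using that(1) less.prems by blast
  qed
  then show ?thesis unfolding forces.simps by blast
qed

lemma CL_sound: "CL A \<Longrightarrow> forces n A"
proof (induction arbitrary: n rule: CL.induct)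
  case (L1 A)
  then show ?case by (simp add: tautology_def flip: eval_prop_forces)
next
  case (L3 A)
  show ?case by (rule forces_Loeb)
next
  case (J4 A B)
  have "\<exists>z<n. forces z B" if "forces n (A \<rhd> B)" "y < n" "forces y A" for y
  proof (cases "forces y B")
    case False
    then have "0 < n" "forces 0 B" using that by auto
    then show ?thesis by blast
  qed (use that in blast)
  then show ?case by (simp del: forces.simps(5)) blast
next
  case (J2 A B C)
  have "forces n (A \<rhd> C)" if "forces n (A \<rhd> B)" "forces n (B \<rhd> C)"
    unfolding forces.simps
  proof (intro allI impI)
    fix y
    assume y: "y < n" "forces y A"
    then have "forces y B \<or> Suc y < n \<and> forces 0 B"
      using that(1) by simp
    \<comment> \<open>The only S-successor of 0 is 0 itself, so a jump to 0 cannot be followed by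
      another move.\<close>
    moreover have "forces 0 B \<Longrightarrow> forces 0 C"
      using that(2) y(1) by auto
    ultimately show "forces y C \<or> Suc y < n \<and> forces 0 C"
      using that(2) y(1) by auto
  qed
  then show ?case by (simp del: forces.simps(5))
qed auto

text \<open>Splits off the top world \<open>m\<close>, the only one that may not jump to 0; the
  condition on the worlds below it is a bounded universal over a fixed predicate.\<close>

lemma forces_Rhd_Suc:
  "forces (Suc m) (A \<rhd> B) \<longleftrightarrow>
     (forces m A \<longrightarrow> forces m B) \<and> (\<forall>y<m. forces y A \<longrightarrow> forces y B \<or> forces 0 B)"
  by (auto simp: less_Suc_eq)

text \<open>As \<open>n\<close> grows, the truth value changes at most once, from true to
  false.\<close>

lemma eventually_constant_bounded_All: "\<exists>N b. \<forall>n\<ge>N. (\<forall>m<n. P m) = b" for P :: "nat \<Rightarrow> bool"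
proof (cases "\<forall>m. P m")
  case False
  then obtain m where "\<not> P m" by blast
  then have "\<forall>n\<ge>Suc m. (\<forall>m<n. P m) = False" by (metis Suc_le_eq)
  then show ?thesis by blast
qed auto

lemma forces_eventually_constant: "\<exists>N b. \<forall>n\<ge>N. forces n A = b"
proof (induction A)
  case (Var p)
  have "\<forall>n\<ge>1. forces n (Var p) = False" by simp
  then show ?case by blast
next
  case (Imp A B)
  then obtain M N a b where "\<forall>n\<ge>M. forces n A = a" "\<forall>n\<ge>N. forces n B = b" by blast
  then have "\<forall>n\<ge>max M N. forces n (A \<^bold>\<longrightarrow> B) = (a \<longrightarrow> b)" by simp
  then show ?case by blast
next
  case (Box A)
  then show ?case using eventually_constant_bounded_All[of "\<lambda>m. forces m A"] by (simp only: forces.simps)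
next
  case (Rhd A B)
  then obtain M N a b where "\<forall>n\<ge>M. forces n A = a" "\<forall>n\<ge>N. forces n B = b" by blast
  moreover obtain K c
    where "\<forall>n\<ge>K. (\<forall>y<n. forces y A \<longrightarrow> forces y B \<or> forces 0 B) = c"
    using eventually_constant_bounded_All[of "\<lambda>y. forces y A \<longrightarrow> forces y B \<or> forces 0 B"] by blast
  ultimately have "\<forall>n\<ge>max K (max M N). forces (Suc n) (A \<rhd> B) = ((a \<longrightarrow> b) \<and> c)"
    by (simp only: forces_Rhd_Suc) simp
  then have "\<forall>n\<ge>Suc (max K (max M N)). forces n (A \<rhd> B) = ((a \<longrightarrow> b) \<and> c)"
    by (metis Suc_le_D Suc_le_mono)
  then show ?case by blast
qed auto

lemma no_fixed_point: "\<not> CL (A \<^bold>\<longleftrightarrow> (A \<rhd> Var q))"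
proof
  assume "CL (A \<^bold>\<longleftrightarrow> (A \<rhd> Var q))"
  then have fixed: "forces n A \<longleftrightarrow> forces n (A \<rhd> Var q)" for n
    using CL_sound[of _ n] by fastforce
  have alternating: "forces (Suc m) A \<longleftrightarrow> \<not> forces m A" if "m > 0" for m
    \<comment> \<open>Worlds below \<open>m\<close> may jump to 0, where \<open>q\<close> holds;
      \<open>m\<close> itself cannot, and \<open>q\<close> fails there since
      \<open>m > 0\<close>.\<close>
    unfolding fixed[of "Suc m"] forces_Rhd_Suc using that by simp
  obtain N b where "\<forall>n\<ge>N. forces n A = b" using forces_eventually_constant by blast
  \<comment> \<open>\<open>Suc N\<close> is positive even if \<open>N\<close> is 0.\<close>
  then show False using alternating[of "Suc N"] by simp
qed

theorem theorem6p1: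
  fixes p q :: nat
  assumes "p \<noteq> q"
  shows "left_modalized p (Var p \<rhd> Var q) \<and>
         (\<forall>A. vars A \<subseteq> {q} \<longrightarrow> \<not> CL (A \<^bold>\<longleftrightarrow> (A \<rhd> Var q)))"
  using assms no_fixed_point by (simp add: left_modalized_def)

end
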